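(* Let $T=M_wEM_u$ be the WCT operator on $L^\Phi(\mu)$. If $w\,\Psi^{-1}(E(\Psi(u)))\in L^{\infty}(\Sigma)$, and $E(uw)$ is bounded away from zero, then for each $n\in\mathbb{N}$, $\mathcal{R}(T^{n+2})=\mathcal{R}(T^{2})$, and so $T$ has finite descent.
   Context: $(X,\Sigma,\mu)$ is a complete $\sigma$-finite measure space; functions are identified when equal $\mu$-a.e. A Young function is a convex even function $\Phi:\mathbb{R}\to[0,\infty]$ with $\Phi(0)=0$, neither identically $0$ nor identically $\infty$ on $(0,\infty)$, and left-continuous at $b_\Phi=\sup\{x>0:\Phi(x)<\infty\}$. Its complementary function is $\Psi(y)=\sup\{x|y|-\Phi(x):x\ge 0\}$; $(\Phi,\Psi)$ is such a pair of complementary Young functions. For a measurable function $f$, $\Phi(f)$ means $\Phi(|f|)$, and similarly for $\Psi$. The generalized inverse is $\Psi^{-1}(y)=\inf\{x\ge0:\Psi(x)>y\}$. The Orlicz space is $L^\Phi(\mu)=L^\Phi(\Sigma)=\{f \text{ measurable}: \exists k>0,\ \int_X\Phi(kf)\,d\mu<\infty\}$, with norm $N_\Phi(f)=\inf\{k>0:\int_X\Phi(f/k)\,d\mu\le1\}$. $\mathcal{A}\subseteq\Sigma$ is a $\sigma$-finite sub-$\sigma$-algebra and $E=E^{\mathcal A}$ is the associated conditional expectation: $E(f)$ is the unique $\mathcal A$-measurable function with $\int_A f\,d\mu=\int_A E(f)\,d\mu$ for all $A\in\mathcal A$. For measurable $u,w:X\to\mathbb{C}$, the weighted conditional type (WCT)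 operator $T=M_wEM_u$ from $L^\Phi(\Sigma)$ into $L^\Phi(\Sigma)$ is defined by $T(f)=wE(uf)$ for every $f\in L^\Phi(\Sigma)$ such that $wE(uf)\in L^\Phi(\Sigma)$; the conditional expectations appearing are understood to be defined. That $E(uw)$ is bounded away from zero means that there is $\delta>0$ with $|E(uw)|\ge\delta$ $\mu$-a.e. on the support $S(E(uw))=\{x\in X: E(uw)(x)\neq0\}$. $\mathcal{R}(S)$ denotes the range of an operator $S$. The descent of $S$ is the smallest non-negative integer $k$ with $\mathcal{R}(S^k)=\mathcal{R}(S^{k+1})$ (it is $\infty$ if there is none). $\mathbb{N}=\{1,2,\dots\}$. *)

theory Defs
  imports
    "HOL-Analysis.Analysis"
    "HOL-Probability.Conditional_Expectation"
    "HOL-Probability.Essential_Supremum"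
    "HOL-Library.Extended_Nat"
begin

section \<open>Young functions\<close>

text \<open>The point \<open>b\<^sub>\<Phi>\<close> is an extended real. If it is infinite, left-continuity at \<open>b\<^sub>\<Phi>\<close> is no
  condition.\<close>

definition young_bound :: "(real \<Rightarrow> ennreal) \<Rightarrow> ereal" where
  "young_bound \<Phi> = Sup (ereal ` {x. 0 < x \<and> \<Phi> x < \<infinity>})"

definition young_function :: "(real \<Rightarrow> ennreal) \<Rightarrow> bool" where
  "young_function \<Phi> \<longleftrightarrow>
     (\<forall>x y t. 0 \<le> t \<longrightarrow> t \<le> 1 \<longrightarrow>
        \<Phi> (t * x + (1 - t) * y) \<le> ennreal t * \<Phi> x + ennreal (1 - t) * \<Phi> y) \<and>
     (\<forall>x. \<Phi> (- x) = \<Phi> x) \<and>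
     \<Phi> 0 = 0 \<and>
     (\<exists>x>0. \<Phi> x \<noteq> 0) \<and>
     (\<exists>x>0. \<Phi> x \<noteq> \<infinity>) \<and>
     (\<forall>b::real. ereal b = young_bound \<Phi> \<longrightarrow> continuous (at_left b) \<Phi>)"

text \<open>Subtraction on \<^typ>\<open>ennreal\<close> is truncated at 0. This does not change the supremum, because
  the term for \<open>x = 0\<close> is 0.\<close>

definition complementary_young :: "(real \<Rightarrow> ennreal) \<Rightarrow> real \<Rightarrow> ennreal" where
  "complementary_young \<Phi> y = (SUP x\<in>{0..}. ennreal (x * \<bar>y\<bar>) - \<Phi> x)"

text \<open>The infimum is taken in \<open>[0, \<infinity>]\<close>, so that it is \<open>\<infinity>\<close> on the empty set.\<close>

definition young_inverse :: "(real \<Rightarrow> ennreal) \<Rightarrow> ennreal \<Rightarrow> ennreal" where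
  "young_inverse \<Psi> y = Inf (ennreal ` {x. 0 \<le> x \<and> \<Psi> x > y})"


section \<open>Orlicz spaces\<close>

definition orlicz_fun :: "'a measure \<Rightarrow> (real \<Rightarrow> ennreal) \<Rightarrow> ('a \<Rightarrow> complex) set" where
  "orlicz_fun M \<Phi> =
     {f \<in> borel_measurable M. \<exists>k>0. (\<integral>\<^sup>+ x. \<Phi> (cmod (complex_of_real k * f x)) \<partial>M) < \<infinity>}"

definition ae_eq_rel :: "'a measure \<Rightarrow> (('a \<Rightarrow> complex) \<times> ('a \<Rightarrow> complex)) set" where
  "ae_eq_rel M =
     {(f, g). f \<in> borel_measurable M \<and> g \<in> borel_measurable M \<and> (AE x in M. f x = g x)}"

definition ae_class :: "'a measure \<Rightarrow> ('a \<Rightarrow> complex) \<Rightarrow> ('a \<Rightarrow> complex) set" where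
  "ae_class M f = ae_eq_rel M `` {f}"

definition orlicz_space :: "'a measure \<Rightarrow> (real \<Rightarrow> ennreal) \<Rightarrow> ('a \<Rightarrow> complex) set set" where
  "orlicz_space M \<Phi> = orlicz_fun M \<Phi> // ae_eq_rel M"

lemma equiv_ae_eq_rel: "equiv (borel_measurable M) (ae_eq_rel M)"
proof (rule equivI)
  show "trans (ae_eq_rel M)"
  proof (rule transI)
    fix f g h assume "(f, g) \<in> ae_eq_rel M" "(g, h) \<in> ae_eq_rel M"
    then have "f \<in> borel_measurable M" "h \<in> borel_measurable M"
      and 1: "AE x in M. f x = g x" and 2: "AE x in M. g x = h x"
      by (auto simp: ae_eq_rel_def)
    moreover have "AE x in M. f x = h x" using 1 2 by eventually_elim simp
    ultimately show "(f, h) \<in> ae_eq_rel M" by (simp add: ae_eq_rel_def)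
  qed
qed (auto simp: ae_eq_rel_def refl_on_def sym_def eq_commute)


section \<open>Conditional expectation of complex functions\<close>

text \<open>The conditional expectation of a complex measurable function \<open>f\<close> is regarded as defined if
  \<open>E(|f|)\<close> is finite almost everywhere. As \<open>F\<close> is sigma-finite, the space is then a countable union of
  sets of \<open>F\<close> on which \<open>f\<close> is integrable, and the identity of integrals over such sets (lemma
  \<open>cond_exp_set_integral\<close> below) determines \<open>E(f)\<close> almost everywhere.\<close>

definition cond_integrable :: "'a measure \<Rightarrow> 'a measure \<Rightarrow> ('a \<Rightarrow> complex) \<Rightarrow> bool" where
  "cond_integrable M F f \<longleftrightarrow>
     f \<in> borel_measurable M \<and>
     (AE x in M. nn_cond_exp M F (\<lambda>x. ennreal (cmod (f x))) x < \<infinity>)"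

definition cond_exp :: "'a measure \<Rightarrow> 'a measure \<Rightarrow> ('a \<Rightarrow> complex) \<Rightarrow> 'a \<Rightarrow> complex" where
  "cond_exp M F f x =
     Complex (real_cond_exp M F (\<lambda>x. Re (f x)) x) (real_cond_exp M F (\<lambda>x. Im (f x)) x)"

lemma cond_exp_measurable [measurable]: "cond_exp M F f \<in> borel_measurable F"
proof -
  have "cond_exp M F f = (\<lambda>x. complex_of_real (real_cond_exp M F (\<lambda>x. Re (f x)) x) +
          \<i> * complex_of_real (real_cond_exp M F (\<lambda>x. Im (f x)) x))"
    by (simp add: fun_eq_iff cond_exp_def complex_eq_iff)
  then show ?thesis by simp
qed

lemma cond_exp_set_integral:
  assumes "sigma_finite_subalgebra M F"
    and f: "f \<in> borel_measurable M" and A: "A \<in> sets F" and int: "set_integrable M A f"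
  shows "set_integrable M A (cond_exp M F f)"
    and "(LINT x:A|M. cond_exp M F f x) = (LINT x:A|M. f x)"
proof -
  interpret sigma_finite_subalgebra M F by fact
  let ?R = "\<lambda>x. Re (f x)" and ?I = "\<lambda>x. Im (f x)"
  have m: "?R \<in> borel_measurable M" "?I \<in> borel_measurable M"
    using f by measurable
  have ind: "(indicator A :: 'a \<Rightarrow> real) \<in> borel_measurable F" using A by simp
  have iR: "integrable M (\<lambda>x. indicator A x * ?R x)"
    and iI: "integrable M (\<lambda>x. indicator A x * ?I x)"
    using integrable_Re[OF int[unfolded set_integrable_def]]
      integrable_Im[OF int[unfolded set_integrable_def]] by simp_all
  note R = real_cond_exp_intg[OF iR ind m(1)]
  note I = real_cond_exp_intg[OF iI ind m(2)]
  have eq: "indicator A x *\<^sub>R cond_exp M F f x =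
      complex_of_real (indicator A x * real_cond_exp M F ?R x) +
      \<i> * complex_of_real (indicator A x * real_cond_exp M F ?I x)" for x
    by (simp add: cond_exp_def complex_eq_iff)
  have eq': "indicator A x *\<^sub>R f x =
      complex_of_real (indicator A x * ?R x) + \<i> * complex_of_real (indicator A x * ?I x)" for x
    by (simp add: complex_eq_iff)
  show "set_integrable M A (cond_exp M F f)"
    unfolding set_integrable_def eq
    by (intro Bochner_Integration.integrable_add integrable_mult_right integrable_of_real R(1) I(1))
  show "(LINT x:A|M. cond_exp M F f x) = (LINT x:A|M. f x)"
    unfolding set_lebesgue_integral_def eq eq'
    by (subst (1 2) Bochner_Integration.integral_add;
        (intro integrable_mult_right integrable_of_real R(1) I(1) iR iI)?)
       (simp only: integral_mult_right_zero integral_complex_of_real R(2) I(2))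
qed

lemma cond_exp_cong:
  assumes "sigma_finite_subalgebra M F"
    and "f \<in> borel_measurable M" "g \<in> borel_measurable M" and "AE x in M. f x = g x"
  shows "AE x in M. cond_exp M F f x = cond_exp M F g x"
proof -
  interpret sigma_finite_subalgebra M F by fact
  note [measurable] = assms(2,3)
  have "AE x in M. real_cond_exp M F (\<lambda>x. Re (f x)) x = real_cond_exp M F (\<lambda>x. Re (g x)) x"
    by (rule real_cond_exp_cong) (use assms(4) in auto)
  moreover have "AE x in M. real_cond_exp M F (\<lambda>x. Im (f x)) x = real_cond_exp M F (\<lambda>x. Im (g x)) x"
    by (rule real_cond_exp_cong) (use assms(4) in auto)
  ultimately show ?thesis by eventually_elim (simp add: cond_exp_def)
qed


section \<open>Partially defined operators and their descent\<close>

text \<open>An operator in a space \<open>V\<close>, defined on a subset of \<open>V\<close>, is represented by its graph, a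
  single-valued relation contained in \<open>V \<times> V\<close>. Powers are compositions on the natural domains. The
  factor \<^term>\<open>Id_on V\<close> matters only for the exponent 0: the power is then the identity of \<open>V\<close>
  and not that of the whole type.\<close>

definition op_power :: "'v set \<Rightarrow> ('v \<times> 'v) set \<Rightarrow> nat \<Rightarrow> ('v \<times> 'v) set" where
  "op_power V S k = Id_on V O (S ^^ k)"

text \<open>In \<^typ>\<open>enat\<close> the infimum of the empty set is \<open>\<infinity>\<close>.\<close>

definition descent :: "'v set \<Rightarrow> ('v \<times> 'v) set \<Rightarrow> enat" where
  "descent V S = Inf (enat ` {k. Range (op_power V S k) = Range (op_power V S (k + 1))})"


section \<open>Weighted conditional type operators\<close>

definition wct_op ::
  "'a measure \<Rightarrow> 'a measure \<Rightarrow> (real \<Rightarrow> ennreal) \<Rightarrow> ('a \<Rightarrow> complex) \<Rightarrow> ('a \<Rightarrow> complex) \<Rightarrow>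
    (('a \<Rightarrow> complex) set \<times> ('a \<Rightarrow> complex) set) set" where
  "wct_op M F \<Phi> w u =
     {(ae_class M f, ae_class M (\<lambda>x. w x * cond_exp M F (\<lambda>x. u x * f x) x)) | f.
        f \<in> orlicz_fun M \<Phi> \<and>
        cond_integrable M F (\<lambda>x. u x * f x) \<and>
        (\<lambda>x. w x * cond_exp M F (\<lambda>x. u x * f x) x) \<in> orlicz_fun M \<Phi>}"

lemma wct_op_subset: "wct_op M F \<Phi> w u \<subseteq> orlicz_space M \<Phi> \<times> orlicz_space M \<Phi>"
  by (auto simp: wct_op_def orlicz_space_def ae_class_def intro!: quotientI)

lemma single_valued_wct_op:
  assumes sub: "sigma_finite_subalgebra M F" and u: "u \<in> borel_measurable M"
  shows "single_valued (wct_op M F \<Phi> w u)"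
proof (rule single_valuedI)
  fix X Y Z assume "(X, Y) \<in> wct_op M F \<Phi> w u" "(X, Z) \<in> wct_op M F \<Phi> w u"
  then obtain f g where
    f: "X = ae_class M f" "Y = ae_class M (\<lambda>x. w x * cond_exp M F (\<lambda>x. u x * f x) x)"
       "f \<in> orlicz_fun M \<Phi>" "(\<lambda>x. w x * cond_exp M F (\<lambda>x. u x * f x) x) \<in> orlicz_fun M \<Phi>" and
    g: "X = ae_class M g" "Z = ae_class M (\<lambda>x. w x * cond_exp M F (\<lambda>x. u x * g x) x)"
       "g \<in> orlicz_fun M \<Phi>" "(\<lambda>x. w x * cond_exp M F (\<lambda>x. u x * g x) x) \<in> orlicz_fun M \<Phi>"
    unfolding wct_op_def by blast
  have fm: "f \<in> borel_measurable M" and gm: "g \<in> borel_measurable M"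
    using f(3) g(3) by (auto simp: orlicz_fun_def)
  have "(f, g) \<in> ae_eq_rel M"
    using f(1) g(1) eq_equiv_class_iff[OF equiv_ae_eq_rel fm gm] by (simp add: ae_class_def)
  then have ae: "AE x in M. f x = g x" by (simp add: ae_eq_rel_def)
  have "AE x in M. cond_exp M F (\<lambda>x. u x * f x) x = cond_exp M F (\<lambda>x. u x * g x) x"
    by (rule cond_exp_cong[OF sub]) (use u fm gm ae in auto)
  then have "AE x in M. w x * cond_exp M F (\<lambda>x. u x * f x) x = w x * cond_exp M F (\<lambda>x. u x * g x) x"
    by eventually_elim simp
  then show "Y = Z"
    unfolding f(2) g(2) ae_class_def using f(4) g(4)
    by (intro equiv_class_eq[OF equiv_ae_eq_rel]) (auto simp: ae_eq_rel_def orlicz_fun_def)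
qed

end

theory Submission
  imports Defs
begin

text \<open>
  Write \<open>G = E(uw)\<close> and \<open>a = E(uf)\<close> for a function \<open>f\<close> in the domain of \<open>T\<close>. As \<open>a\<close> and \<open>G\<close> are
  measurable for the subalgebra \<open>F\<close>, they can be pulled out of the conditional expectation: \<open>T\<close> maps
  \<open>wa\<close> to \<open>wGa\<close> for every \<open>F\<close>-measurable \<open>a\<close> such that both functions are in the Orlicz space (lemma
  \<open>wct_op_on_multiples_of_weight\<close>). So \<open>T\<close> acts as
  multiplication by \<open>G\<close> on multiples of \<open>w\<close> by \<open>F\<close>-measurable factors, all values of \<open>T\<close> are such
  multiples, and on the support of \<open>G\<close> this multiplication can be undone: \<open>1/G\<close> is bounded there by
  \<open>1/\<delta>\<close>, and multiplication by a bounded function preserves the Orlicz space.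

  Concretely, \<open>T\<^sup>2f = wGa\<close>. Read \<open>1/G\<close> as 0 where \<open>G = 0\<close>, and put \<open>g = wa/G\<^sup>2\<close>. This is
  \<open>Tf\<close> times a bounded function, and \<open>T\<close> maps it successively to \<open>wa/G\<close>, to \<open>wa\<close> cut off to the
  support of \<open>G\<close>, and to \<open>wGa\<close>, which vanishes outside that support anyway. Every step stays in the
  Orlicz space, so \<open>T\<^sup>2f = T\<^sup>3g\<close>. Hence \<open>T\<^sup>2\<close> and \<open>T\<^sup>3\<close> have the same range, and it
  is formal that the ranges of all higher powers agree with it.

  The conditional expectation is used here for functions that need not be integrable over the whole
  space, only conditionally integrable. Additivity and the pull-out property in this generality come
  from those of the conditional expectation of nonnegative functions, where values in \<open>[0, \<infinity>]\<close>
  are allowed: lemma \<open>real_cond_exp_diff_nonneg\<close> reduces one to the other.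
\<close>


section \<open>Conditional expectation without global integrability\<close>

text \<open>The definition of \<^const>\<open>real_cond_exp\<close> uses the splitting into positive and negative part.
  Any other splitting \<open>p - q\<close> with finite conditional expectations gives the same value, because
  \<open>f\<^sup>+ + q = f\<^sup>- + p\<close>, and \<open>f\<^sup>+ \<le> p\<close> and \<open>f\<^sup>- \<le> q\<close>
  make all four expectations finite. This allows choosing splittings adapted to differences and
  products, whose positive part has no convenient expression.\<close>

lemma (in sigma_finite_subalgebra) real_cond_exp_diff_nonneg:
  assumes [measurable]: "p \<in> borel_measurable M" "q \<in> borel_measurable M"
    and nonneg: "\<And>x. 0 \<le> p x" "\<And>x. 0 \<le> q x" and diff: "\<And>x. f x = p x - q x"
    and finite: "AE x in M. nn_cond_exp M F (\<lambda>x. ennreal (p x)) x < \<infinity>"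
      "AE x in M. nn_cond_exp M F (\<lambda>x. ennreal (q x)) x < \<infinity>"
  shows "AE x in M. real_cond_exp M F f x =
    enn2real (nn_cond_exp M F (\<lambda>x. ennreal (p x)) x) -
    enn2real (nn_cond_exp M F (\<lambda>x. ennreal (q x)) x)"
proof -
  define r s where "r = (\<lambda>x. max 0 (f x))" and "s = (\<lambda>x. max 0 (- f x))"
  have f_eq: "f = (\<lambda>x. p x - q x)" using diff by auto
  have [measurable]: "r \<in> borel_measurable M" "s \<in> borel_measurable M"
    unfolding r_def s_def f_eq by measurable
  have r0: "r x \<ge> 0" and s0: "s x \<ge> 0" for x by (auto simp: r_def s_def)
  have rf: "(\<lambda>x. ennreal (f x)) = (\<lambda>x. ennreal (r x))"
    and sf: "(\<lambda>x. ennreal (- f x)) = (\<lambda>x. ennreal (s x))"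
    by (auto simp: r_def s_def max_def ennreal_neg)
  have balance: "(\<lambda>x. ennreal (r x) + ennreal (q x)) = (\<lambda>x. ennreal (s x) + ennreal (p x))"
    using r0 s0 nonneg
    by (auto simp: fun_eq_iff r_def s_def diff max_def simp flip: ennreal_plus)
  have rp: "AE x in M. nn_cond_exp M F (\<lambda>x. ennreal (r x)) x \<le> nn_cond_exp M F (\<lambda>x. ennreal (p x)) x"
    by (rule nn_cond_exp_mono) (use nonneg in \<open>auto simp: r_def diff intro!: ennreal_leI\<close>)
  have sq: "AE x in M. nn_cond_exp M F (\<lambda>x. ennreal (s x)) x \<le> nn_cond_exp M F (\<lambda>x. ennreal (q x)) x"
    by (rule nn_cond_exp_mono) (use nonneg in \<open>auto simp: s_def diff intro!: ennreal_leI\<close>)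
  have rq: "AE x in M. nn_cond_exp M F (\<lambda>x. ennreal (r x)) x + nn_cond_exp M F (\<lambda>x. ennreal (q x)) x
      = nn_cond_exp M F (\<lambda>x. ennreal (r x) + ennreal (q x)) x"
    by (rule nn_cond_exp_sum) measurable
  have sp: "AE x in M. nn_cond_exp M F (\<lambda>x. ennreal (s x)) x + nn_cond_exp M F (\<lambda>x. ennreal (p x)) x
      = nn_cond_exp M F (\<lambda>x. ennreal (s x) + ennreal (p x)) x"
    by (rule nn_cond_exp_sum) measurable
  show ?thesis
    using rp sq rq sp finite
  proof eventually_elim
    case (elim x)
    let ?E = "\<lambda>h. nn_cond_exp M F (\<lambda>x. ennreal (h x)) x"
    have fin: "?E r < top" "?E s < top" "?E p < top" "?E q < top"
      using elim by (auto intro: le_less_trans)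
    have "?E r + ?E q = ?E s + ?E p" using elim balance by simp
    then have "enn2real (?E r) + enn2real (?E q) = enn2real (?E s) + enn2real (?E p)"
      using fin by (metis enn2real_plus)
    then show ?case unfolding real_cond_exp_def rf sf by simp
  qed
qed

lemma (in sigma_finite_subalgebra) nn_cond_exp_pos_neg_parts_finite:
  assumes [measurable]: "f \<in> borel_measurable M"
    and finite: "AE x in M. nn_cond_exp M F (\<lambda>x. ennreal \<bar>f x\<bar>) x < \<infinity>"
  shows "AE x in M. nn_cond_exp M F (\<lambda>x. ennreal (f x)) x < \<infinity> \<and>
    nn_cond_exp M F (\<lambda>x. ennreal (- f x)) x < \<infinity>"
proof -
  have "AE x in M. nn_cond_exp M F (\<lambda>x. ennreal (f x)) x \<le> nn_cond_exp M F (\<lambda>x. ennreal \<bar>f x\<bar>) x"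
    by (rule nn_cond_exp_mono) (auto intro!: ennreal_leI)
  moreover have "AE x in M. nn_cond_exp M F (\<lambda>x. ennreal (- f x)) x
      \<le> nn_cond_exp M F (\<lambda>x. ennreal \<bar>f x\<bar>) x"
    by (rule nn_cond_exp_mono) (auto intro!: ennreal_leI)
  ultimately show ?thesis using finite by eventually_elim auto
qed

lemma (in sigma_finite_subalgebra) real_cond_exp_diff_cond_integrable:
  assumes f [measurable]: "f \<in> borel_measurable M" and g [measurable]: "g \<in> borel_measurable M"
    and finite: "AE x in M. nn_cond_exp M F (\<lambda>x. ennreal \<bar>f x\<bar>) x < \<infinity>"
      "AE x in M. nn_cond_exp M F (\<lambda>x. ennreal \<bar>g x\<bar>) x < \<infinity>"
  shows "AE x in M. real_cond_exp M F (\<lambda>x. f x - g x) x = real_cond_exp M F f x - real_cond_exp M F g x"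
proof -
  let ?E = "\<lambda>h. nn_cond_exp M F (\<lambda>x. ennreal (h x))"
  define p q where "p = (\<lambda>x. max 0 (f x) + max 0 (- g x))" and "q = (\<lambda>x. max 0 (- f x) + max 0 (g x))"
  have [measurable]: "p \<in> borel_measurable M" "q \<in> borel_measurable M"
    unfolding p_def q_def by measurable
  have pq: "(\<lambda>x. ennreal (p x)) = (\<lambda>x. ennreal (f x) + ennreal (- g x))"
    "(\<lambda>x. ennreal (q x)) = (\<lambda>x. ennreal (- f x) + ennreal (g x))"
    by (auto simp: p_def q_def max_def ennreal_neg simp flip: ennreal_plus)
  have Ep: "AE x in M. ?E f x + ?E (\<lambda>x. - g x) x = ?E p x"
    unfolding pq by (rule nn_cond_exp_sum) measurable
  have Eq: "AE x in M. ?E (\<lambda>x. - f x) x + ?E g x = ?E q x"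
    unfolding pq by (rule nn_cond_exp_sum) measurable
  note fin = nn_cond_exp_pos_neg_parts_finite[OF f finite(1)] nn_cond_exp_pos_neg_parts_finite[OF g finite(2)]
  have "AE x in M. ?E p x < \<infinity>"
    using Ep fin by eventually_elim (metis ennreal_add_less_top infinity_ennreal_def)
  moreover have "AE x in M. ?E q x < \<infinity>"
    using Eq fin by eventually_elim (metis ennreal_add_less_top infinity_ennreal_def)
  ultimately have "AE x in M. real_cond_exp M F (\<lambda>x. f x - g x) x = enn2real (?E p x) - enn2real (?E q x)"
    by (intro real_cond_exp_diff_nonneg) (auto simp: p_def q_def)
  then show ?thesis using Ep Eq fin
  proof eventually_elim
    case (elim x)
    have "enn2real (?E p x) = enn2real (?E f x) + enn2real (?E (\<lambda>x. - g x) x)"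
      unfolding elim(2)[symmetric] using elim by (intro enn2real_plus) auto
    moreover have "enn2real (?E q x) = enn2real (?E (\<lambda>x. - f x) x) + enn2real (?E g x)"
      unfolding elim(3)[symmetric] using elim by (intro enn2real_plus) auto
    ultimately show ?case unfolding elim(1) unfolding real_cond_exp_def by linarith
  qed
qed

text \<open>Here the adapted splitting is \<open>ah = (a\<^sup>+h\<^sup>+ + a\<^sup>-h\<^sup>-) - (a\<^sup>+h\<^sup>- + a\<^sup>-h\<^sup>+)\<close>. In each of the four
  products, the factor from \<open>a\<close> is nonnegative and \<open>F\<close>-measurable, so it can be pulled out.\<close>

lemma (in sigma_finite_subalgebra) real_cond_exp_mult_cond_integrable:
  assumes a [measurable]: "a \<in> borel_measurable F" and h [measurable]: "h \<in> borel_measurable M"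
    and finite: "AE x in M. nn_cond_exp M F (\<lambda>x. ennreal \<bar>h x\<bar>) x < \<infinity>"
  shows "AE x in M. real_cond_exp M F (\<lambda>x. a x * h x) x = a x * real_cond_exp M F h x"
proof -
  let ?E = "\<lambda>h. nn_cond_exp M F (\<lambda>x. ennreal (h x))"
  have aM [measurable]: "a \<in> borel_measurable M" by (rule measurable_from_subalg[OF subalg a])
  define p q where "p = (\<lambda>x. max 0 (a x) * max 0 (h x) + max 0 (- a x) * max 0 (- h x))"
    and "q = (\<lambda>x. max 0 (a x) * max 0 (- h x) + max 0 (- a x) * max 0 (h x))"
  have [measurable]: "p \<in> borel_measurable M" "q \<in> borel_measurable M"
    unfolding p_def q_def by measurable
  have mult_max: "ennreal (max 0 s * max 0 t) = ennreal s * ennreal t" for s t :: real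
    by (cases "0 \<le> s"; cases "0 \<le> t") (simp_all add: ennreal_mult ennreal_neg)
  have pq: "(\<lambda>x. ennreal (p x)) = (\<lambda>x. ennreal (a x) * ennreal (h x) + ennreal (- a x) * ennreal (- h x))"
    "(\<lambda>x. ennreal (q x)) = (\<lambda>x. ennreal (a x) * ennreal (- h x) + ennreal (- a x) * ennreal (h x))"
    by (simp_all add: p_def q_def fun_eq_iff mult_max)
  have prod: "AE x in M. ennreal (b x) * nn_cond_exp M F (\<lambda>x. ennreal (k x)) x =
      nn_cond_exp M F (\<lambda>x. ennreal (b x) * ennreal (k x)) x"
    if [measurable]: "b \<in> borel_measurable F" "k \<in> borel_measurable M" for b k :: "'a \<Rightarrow> real"
    by (rule nn_cond_exp_prod) measurable
  have sum: "AE x in M. nn_cond_exp M F (\<lambda>x. ennreal (b x) * ennreal (k x)) x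
       + nn_cond_exp M F (\<lambda>x. ennreal (c x) * ennreal (l x)) x
      = nn_cond_exp M F (\<lambda>x. ennreal (b x) * ennreal (k x) + ennreal (c x) * ennreal (l x)) x"
    if [measurable]: "b \<in> borel_measurable M" "k \<in> borel_measurable M"
      "c \<in> borel_measurable M" "l \<in> borel_measurable M" for b c k l :: "'a \<Rightarrow> real"
    by (rule nn_cond_exp_sum) measurable
  have ma [measurable]: "(\<lambda>x. - a x) \<in> borel_measurable F" "(\<lambda>x. - h x) \<in> borel_measurable M"
    "(\<lambda>x. - a x) \<in> borel_measurable M"
    by measurable
  have Ep: "AE x in M. ?E p x = ennreal (a x) * ?E h x + ennreal (- a x) * ?E (\<lambda>x. - h x) x"
    unfolding pq using sum[OF aM h ma(3,2)] prod[OF a h] prod[OF ma(1,2)]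
    by eventually_elim simp
  have Eq: "AE x in M. ?E q x = ennreal (a x) * ?E (\<lambda>x. - h x) x + ennreal (- a x) * ?E h x"
    unfolding pq using sum[OF aM ma(2,3) h] prod[OF a ma(2)] prod[OF ma(1) h]
    by eventually_elim simp
  note fin = nn_cond_exp_pos_neg_parts_finite[OF h finite]
  have "AE x in M. ?E p x < \<infinity>"
    using Ep fin by eventually_elim (auto simp: ennreal_mult_less_top)
  moreover have "AE x in M. ?E q x < \<infinity>"
    using Eq fin by eventually_elim (auto simp: ennreal_mult_less_top)
  moreover have "a x * h x = p x - q x" for x
    by (auto simp: p_def q_def max_def)
  ultimately have "AE x in M. real_cond_exp M F (\<lambda>x. a x * h x) x = enn2real (?E p x) - enn2real (?E q x)"
    by (intro real_cond_exp_diff_nonneg) (auto simp: p_def q_def)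
  then show ?thesis using Ep Eq fin
  proof eventually_elim
    case (elim x)
    have "enn2real (?E p x) = enn2real (ennreal (a x)) * enn2real (?E h x)
          + enn2real (ennreal (- a x)) * enn2real (?E (\<lambda>x. - h x) x)"
      "enn2real (?E q x) = enn2real (ennreal (a x)) * enn2real (?E (\<lambda>x. - h x) x)
          + enn2real (ennreal (- a x)) * enn2real (?E h x)"
      using elim by (simp_all add: enn2real_plus enn2real_mult ennreal_mult_less_top)
    then show ?case
      using elim(1) unfolding real_cond_exp_def
      by (cases "a x \<ge> 0") (auto simp: ennreal_neg algebra_simps)
  qed
qed

lemma (in sigma_finite_subalgebra) cond_integrable_dominated_finite:
  assumes h: "cond_integrable M F h" and [measurable]: "k \<in> borel_measurable M"
    and le: "\<And>x. \<bar>k x\<bar> \<le> cmod (h x)"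
  shows "AE x in M. nn_cond_exp M F (\<lambda>x. ennreal \<bar>k x\<bar>) x < \<infinity>"
proof -
  have [measurable]: "h \<in> borel_measurable M" using h by (simp add: cond_integrable_def)
  have "AE x in M. nn_cond_exp M F (\<lambda>x. ennreal \<bar>k x\<bar>) x \<le> nn_cond_exp M F (\<lambda>x. ennreal (cmod (h x))) x"
    by (rule nn_cond_exp_mono) (auto intro!: ennreal_leI le)
  moreover have "AE x in M. nn_cond_exp M F (\<lambda>x. ennreal (cmod (h x))) x < \<infinity>"
    using h by (simp add: cond_integrable_def)
  ultimately show ?thesis by eventually_elim auto
qed

lemma (in sigma_finite_subalgebra) cond_integrable_mult:
  assumes a [measurable]: "a \<in> borel_measurable F" and h: "cond_integrable M F h"
  shows "cond_integrable M F (\<lambda>x. a x * h x)"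
proof -
  have [measurable]: "h \<in> borel_measurable M" using h by (simp add: cond_integrable_def)
  have [measurable]: "a \<in> borel_measurable M" by (rule measurable_from_subalg[OF subalg a])
  have fin: "AE x in M. nn_cond_exp M F (\<lambda>x. ennreal (cmod (h x))) x < \<infinity>"
    using h by (simp add: cond_integrable_def)
  have "AE x in M. ennreal (cmod (a x)) * nn_cond_exp M F (\<lambda>x. ennreal (cmod (h x))) x =
      nn_cond_exp M F (\<lambda>x. ennreal (cmod (a x)) * ennreal (cmod (h x))) x"
    by (rule nn_cond_exp_prod) measurable
  with fin have "AE x in M. nn_cond_exp M F (\<lambda>x. ennreal (cmod (a x)) * ennreal (cmod (h x))) x < \<infinity>"
    by eventually_elim (metis ennreal_less_top ennreal_mult_less_top infinity_ennreal_def)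
  then show ?thesis
    by (simp add: cond_integrable_def norm_mult ennreal_mult)
qed

lemma (in sigma_finite_subalgebra) cond_exp_mult:
  assumes a [measurable]: "a \<in> borel_measurable F" and h: "cond_integrable M F h"
  shows "AE x in M. cond_exp M F (\<lambda>x. a x * h x) x = a x * cond_exp M F h x"
proof -
  have [measurable]: "h \<in> borel_measurable M" using h by (simp add: cond_integrable_def)
  have [measurable]: "a \<in> borel_measurable M" by (rule measurable_from_subalg[OF subalg a])
  note ah = cond_integrable_mult[OF a h]
  have bound: "\<bar>Re z * Re v\<bar> \<le> cmod (z * v)" "\<bar>Im z * Im v\<bar> \<le> cmod (z * v)"
    "\<bar>Re z * Im v\<bar> \<le> cmod (z * v)" "\<bar>Im z * Re v\<bar> \<le> cmod (z * v)" for z v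
    using abs_Re_le_cmod abs_Im_le_cmod by (auto simp: abs_mult norm_mult intro!: mult_mono)
  have hfin: "AE x in M. nn_cond_exp M F (\<lambda>x. ennreal \<bar>Re (h x)\<bar>) x < \<infinity>"
    "AE x in M. nn_cond_exp M F (\<lambda>x. ennreal \<bar>Im (h x)\<bar>) x < \<infinity>"
    by (intro cond_integrable_dominated_finite[OF h] abs_Re_le_cmod abs_Im_le_cmod; measurable)+
  let ?R = "real_cond_exp M F"
  have re: "AE x in M. ?R (\<lambda>x. Re (a x) * Re (h x) - Im (a x) * Im (h x)) x =
      ?R (\<lambda>x. Re (a x) * Re (h x)) x - ?R (\<lambda>x. Im (a x) * Im (h x)) x"
    by (intro real_cond_exp_diff_cond_integrable cond_integrable_dominated_finite[OF ah] bound; measurable)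
  have im: "AE x in M. ?R (\<lambda>x. Re (a x) * Im (h x) - (- Im (a x)) * Re (h x)) x =
      ?R (\<lambda>x. Re (a x) * Im (h x)) x - ?R (\<lambda>x. (- Im (a x)) * Re (h x)) x"
    using bound
    by (intro real_cond_exp_diff_cond_integrable cond_integrable_dominated_finite[OF ah]; (measurable | simp))
  have m [measurable]: "(\<lambda>x. Re (a x)) \<in> borel_measurable F" "(\<lambda>x. Im (a x)) \<in> borel_measurable F"
    "(\<lambda>x. - Im (a x)) \<in> borel_measurable F"
    "(\<lambda>x. Re (h x)) \<in> borel_measurable M" "(\<lambda>x. Im (h x)) \<in> borel_measurable M"
    by measurable
  note pull = real_cond_exp_mult_cond_integrable
  show ?thesis
    using re im pull[OF m(1,4) hfin(1)] pull[OF m(1,5) hfin(2)] pull[OF m(2,5) hfin(2)]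
      pull[OF m(3,4) hfin(1)]
    by eventually_elim (simp add: cond_exp_def complex_eq_iff)
qed


section \<open>Orlicz spaces as ideals\<close>

text \<open>Convexity between \<open>0\<close> and \<open>y\<close>.\<close>

lemma young_function_mono:
  assumes "young_function \<Phi>" and "0 \<le> x" "x \<le> y"
  shows "\<Phi> x \<le> \<Phi> y"
proof (cases "y = 0")
  case False
  define t where "t = x / y"
  have t: "0 \<le> t" "t \<le> 1" "x = t * y" using assms False by (auto simp: t_def divide_simps)
  have "\<Phi> (t * y + (1 - t) * 0) \<le> ennreal t * \<Phi> y + ennreal (1 - t) * \<Phi> 0" "\<Phi> 0 = 0"
    using assms(1) t unfolding young_function_def by blast+
  then have "\<Phi> x \<le> ennreal t * \<Phi> y" using t by simp
  also have "\<dots> \<le> 1 * \<Phi> y" using t by (intro mult_right_mono) auto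
  finally show ?thesis by simp
qed (use assms in auto)

lemma orlicz_fun_dominated:
  assumes \<Phi>: "young_function \<Phi>" and f: "f \<in> orlicz_fun M \<Phi>" and g: "g \<in> borel_measurable M"
    and "c > 0" and le: "AE x in M. cmod (g x) \<le> c * cmod (f x)"
  shows "g \<in> orlicz_fun M \<Phi>"
proof -
  obtain k where k: "k > 0" "(\<integral>\<^sup>+ x. \<Phi> (cmod (complex_of_real k * f x)) \<partial>M) < \<infinity>"
    using f unfolding orlicz_fun_def by blast
  have "(\<integral>\<^sup>+ x. \<Phi> (cmod (complex_of_real (k / c) * g x)) \<partial>M)
      \<le> (\<integral>\<^sup>+ x. \<Phi> (cmod (complex_of_real k * f x)) \<partial>M)"
  proof (rule nn_integral_mono_AE)
    show "AE x in M. \<Phi> (cmod (complex_of_real (k / c) * g x)) \<le> \<Phi> (cmod (complex_of_real k * f x))"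
      using le
    proof eventually_elim
      case (elim x)
      have "k / c * cmod (g x) \<le> k / c * (c * cmod (f x))"
        using elim k \<open>c > 0\<close> by (intro mult_left_mono) auto
      then have "cmod (complex_of_real (k / c) * g x) \<le> cmod (complex_of_real k * f x)"
        using k \<open>c > 0\<close> by (simp add: norm_mult norm_divide)
      then show ?case by (intro young_function_mono[OF \<Phi>]) auto
    qed
  qed
  then show ?thesis
    using k \<open>c > 0\<close> g unfolding orlicz_fun_def
    by (auto intro!: exI[of _ "k / c"] elim: le_less_trans)
qed


section \<open>The operator as a multiplication\<close>

lemma ae_class_eq:
  assumes "f \<in> borel_measurable M" "g \<in> borel_measurable M"
  shows "ae_class M f = ae_class M g \<longleftrightarrow> (AE x in M. f x = g x)"
  unfolding ae_class_def eq_equiv_class_iff[OF equiv_ae_eq_rel assms]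
  using assms by (simp add: ae_eq_rel_def)

text \<open>The reason is \<open>E(uwa) = E(uw) a\<close>. As \<open>h\<close> may be any representative of its class,
  the lemma can be applied with a prescribed value of the operator.\<close>

lemma wct_op_on_multiples_of_weight:
  assumes sub: "sigma_finite_subalgebra M F" and \<Phi>: "young_function \<Phi>"
    and [measurable]: "u \<in> borel_measurable M" "w \<in> borel_measurable M"
    and uw: "cond_integrable M F (\<lambda>x. u x * w x)" and a [measurable]: "a \<in> borel_measurable F"
    and g: "g \<in> orlicz_fun M \<Phi>" "AE x in M. g x = w x * a x"
    and h: "h \<in> orlicz_fun M \<Phi>" "AE x in M. h x = w x * (cond_exp M F (\<lambda>x. u x * w x) x * a x)"
  shows "(ae_class M g, ae_class M h) \<in> wct_op M F \<Phi> w u"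
proof -
  interpret sigma_finite_subalgebra M F by fact
  have [measurable]: "a \<in> borel_measurable M" by (rule measurable_from_subalg[OF subalg a])
  have [measurable]: "g \<in> borel_measurable M" "h \<in> borel_measurable M"
    using g h by (auto simp: orlicz_fun_def)
  have [measurable]: "cond_exp M F k \<in> borel_measurable M" for k
    by (rule measurable_from_subalg[OF subalg cond_exp_measurable])
  let ?ug = "\<lambda>x. u x * g x" and ?auw = "\<lambda>x. a x * (u x * w x)"
  have eq: "AE x in M. ?ug x = ?auw x" using g(2) by eventually_elim simp
  have ci: "cond_integrable M F ?auw" by (rule cond_integrable_mult[OF a uw])
  have "AE x in M. ennreal (cmod (?ug x)) = ennreal (cmod (?auw x))"
    using eq by eventually_elim (simp only:)
  then have "AE x in M. nn_cond_exp M F (\<lambda>x. ennreal (cmod (?ug x))) x =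
      nn_cond_exp M F (\<lambda>x. ennreal (cmod (?auw x))) x"
    by (rule nn_cond_exp_cong) measurable
  moreover have "AE x in M. nn_cond_exp M F (\<lambda>x. ennreal (cmod (?auw x))) x < \<infinity>"
    using ci by (simp add: cond_integrable_def)
  ultimately have "AE x in M. nn_cond_exp M F (\<lambda>x. ennreal (cmod (?ug x))) x < \<infinity>"
    by eventually_elim simp
  then have dom: "cond_integrable M F ?ug" by (simp add: cond_integrable_def)
  have "AE x in M. cond_exp M F ?ug x = cond_exp M F ?auw x"
    by (rule cond_exp_cong[OF sub]) (use eq in auto)
  then have val: "AE x in M. h x = w x * cond_exp M F ?ug x"
    using cond_exp_mult[OF a uw] h(2) by eventually_elim simp
  have "(\<lambda>x. w x * cond_exp M F ?ug x) \<in> orlicz_fun M \<Phi>"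
    by (rule orlicz_fun_dominated[OF \<Phi> h(1), of _ 1]) (use val in \<open>auto elim: eventually_mono\<close>)
  moreover have "ae_class M h = ae_class M (\<lambda>x. w x * cond_exp M F ?ug x)"
    by (subst ae_class_eq) (use val in auto)
  ultimately show ?thesis
    using dom g(1) unfolding wct_op_def by blast
qed

text \<open>The witness is \<open>wa/G\<^sup>2\<close> with \<open>G = E(uw)\<close>. One power of \<open>1/G\<close> less would not do: \<open>T\<^sup>2\<close>, not
  \<open>T\<^sup>3\<close>, would map \<open>wa/G\<close> to \<open>wGa\<close>. With the convention \<open>1/0 = 0\<close>, the factor \<open>1/G\<close> already
  contains the restriction to the support of \<open>G\<close>.\<close>

lemma wct_op_square_range_subset:
  assumes sub: "sigma_finite_subalgebra M F" and \<Phi>: "young_function \<Phi>"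
    and u [measurable]: "u \<in> borel_measurable M" and w [measurable]: "w \<in> borel_measurable M"
    and uw: "cond_integrable M F (\<lambda>x. u x * w x)"
    and "\<delta> > 0" and bounded_away: "AE x in M. cond_exp M F (\<lambda>x. u x * w x) x \<noteq> 0 \<longrightarrow>
           cmod (cond_exp M F (\<lambda>x. u x * w x) x) \<ge> \<delta>"
    and XY: "(X, Y) \<in> wct_op M F \<Phi> w u" and YZ: "(Y, Z) \<in> wct_op M F \<Phi> w u"
  shows "\<exists>X'. (X', Z) \<in> wct_op M F \<Phi> w u ^^ 3"
proof -
  interpret sigma_finite_subalgebra M F by fact
  let ?T = "wct_op M F \<Phi> w u"
  define G where "G = cond_exp M F (\<lambda>x. u x * w x)"
  obtain f where f: "Y = ae_class M (\<lambda>x. w x * cond_exp M F (\<lambda>x. u x * f x) x)"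
      "(\<lambda>x. w x * cond_exp M F (\<lambda>x. u x * f x) x) \<in> orlicz_fun M \<Phi>"
    using XY unfolding wct_op_def by blast
  define a where "a = cond_exp M F (\<lambda>x. u x * f x)"
  have Y: "Y = ae_class M (\<lambda>x. w x * a x)" and wa: "(\<lambda>x. w x * a x) \<in> orlicz_fun M \<Phi>"
    using f by (simp_all add: a_def)
  obtain g where g: "Y = ae_class M g" "g \<in> orlicz_fun M \<Phi>"
      "Z = ae_class M (\<lambda>x. w x * cond_exp M F (\<lambda>x. u x * g x) x)"
      "(\<lambda>x. w x * cond_exp M F (\<lambda>x. u x * g x) x) \<in> orlicz_fun M \<Phi>"
    using YZ unfolding wct_op_def by blast
  define h where "h = (\<lambda>x. w x * cond_exp M F (\<lambda>x. u x * g x) x)"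
  have Z: "Z = ae_class M h" and h: "h \<in> orlicz_fun M \<Phi>" using g by (simp_all add: h_def)
  have aF [measurable]: "a \<in> borel_measurable F" and GF [measurable]: "G \<in> borel_measurable F"
    by (simp_all add: a_def G_def)
  have [measurable]: "a \<in> borel_measurable M" "G \<in> borel_measurable M"
    by (rule measurable_from_subalg[OF subalg], fact)+
  have [measurable]: "g \<in> borel_measurable M" using g(2) by (simp add: orlicz_fun_def)
  have "AE x in M. g x = w x * a x"
    using g(1) Y by (subst ae_class_eq[symmetric]) auto
  then have eq: "AE x in M. u x * g x = a x * (u x * w x)" by eventually_elim simp
  have "AE x in M. cond_exp M F (\<lambda>x. u x * g x) x = cond_exp M F (\<lambda>x. a x * (u x * w x)) x"
    by (rule cond_exp_cong[OF sub]) (use eq in auto)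
  then have h_eq: "AE x in M. h x = w x * (G x * a x)"
    using cond_exp_mult[OF aF uw] by eventually_elim (simp add: h_def G_def)
  have inv: "AE x in M. cmod (inverse (G x)) \<le> inverse \<delta>"
    using bounded_away
  proof eventually_elim
    case (elim x)
    then show ?case using \<open>\<delta> > 0\<close>
      by (cases "G x = 0") (auto simp: G_def norm_inverse intro!: le_imp_inverse_le)
  qed
  define g0 g1 g2 where "g0 = (\<lambda>x. w x * (inverse (G x) * inverse (G x) * a x))"
    and "g1 = (\<lambda>x. w x * (inverse (G x) * a x))"
    and "g2 = (\<lambda>x. w x * (G x * inverse (G x) * a x))"
  have g1: "g1 \<in> orlicz_fun M \<Phi>"
  proof (rule orlicz_fun_dominated[OF \<Phi> wa])
    show "AE x in M. cmod (g1 x) \<le> inverse \<delta> * cmod (w x * a x)"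
      using inv
    proof eventually_elim
      case (elim x)
      have "cmod (g1 x) = cmod (inverse (G x)) * cmod (w x * a x)"
        by (simp add: g1_def norm_mult)
      also have "\<dots> \<le> inverse \<delta> * cmod (w x * a x)"
        using elim by (rule mult_right_mono) simp
      finally show ?case .
    qed
  qed (use \<open>\<delta> > 0\<close> in \<open>auto simp: g1_def\<close>)
  have g0: "g0 \<in> orlicz_fun M \<Phi>"
  proof (rule orlicz_fun_dominated[OF \<Phi> g1])
    show "AE x in M. cmod (g0 x) \<le> inverse \<delta> * cmod (g1 x)"
      using inv
    proof eventually_elim
      case (elim x)
      have "cmod (g0 x) = cmod (inverse (G x)) * cmod (g1 x)"
        by (simp add: g0_def g1_def norm_mult)
      also have "\<dots> \<le> inverse \<delta> * cmod (g1 x)"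
        using elim by (rule mult_right_mono) simp
      finally show ?case .
    qed
  qed (use \<open>\<delta> > 0\<close> in \<open>auto simp: g0_def\<close>)
  have g2: "g2 \<in> orlicz_fun M \<Phi>"
  proof (rule orlicz_fun_dominated[OF \<Phi> wa, of _ 1])
    have "cmod (g2 x) \<le> 1 * cmod (w x * a x)" for x
      by (cases "G x = 0") (auto simp: g2_def)
    then show "AE x in M. cmod (g2 x) \<le> 1 * cmod (w x * a x)" by simp
  qed (auto simp: g2_def)
  note step = wct_op_on_multiples_of_weight[OF sub \<Phi> u w uw, folded G_def]
  have "(ae_class M g0, ae_class M g1) \<in> ?T"
  proof (rule step[OF _ g0 _ g1])
    have "g1 x = w x * (G x * (inverse (G x) * inverse (G x) * a x))" for x
      by (cases "G x = 0") (simp_all add: g1_def)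
    then show "AE x in M. g1 x = w x * (G x * (inverse (G x) * inverse (G x) * a x))" by simp
  qed (simp_all add: g0_def)
  moreover have "(ae_class M g1, ae_class M g2) \<in> ?T"
    by (rule step[OF _ g1 _ g2, of "\<lambda>x. inverse (G x) * a x"]) (simp_all add: g1_def g2_def mult.assoc)
  moreover have "(ae_class M g2, ae_class M h) \<in> ?T"
  proof (rule step[OF _ g2 _ h])
    show "AE x in M. h x = w x * (G x * (G x * inverse (G x) * a x))"
      using h_eq
    proof eventually_elim
      case (elim x)
      then show ?case by (cases "G x = 0") simp_all
    qed
  qed (simp_all add: g2_def)
  ultimately show ?thesis unfolding Z by (auto simp: numeral_3_eq_3)
qed


section \<open>Stabilization of ranges\<close>

lemma op_power_eq_relpow:
  assumes "S \<subseteq> V \<times> V" and "k \<ge> 1"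
  shows "op_power V S k = S ^^ k"
proof -
  obtain j where k: "k = Suc j" using assms(2) by (cases k) auto
  have "x \<in> V" if "(x, y) \<in> S ^^ Suc j" for x y
    using relpow_Suc_D2[OF that] assms(1) by auto
  then show ?thesis unfolding op_power_def k by (auto simp del: relpow.simps)
qed

lemma Range_relpow_stable:
  fixes S :: "('v \<times> 'v) set"
  assumes "Range (S ^^ Suc m) = Range (S ^^ m)"
  shows "Range (S ^^ (n + m)) = Range (S ^^ m)"
proof (induction n)
  case (Suc n)
  have "Range (S ^^ (Suc n + m)) = S `` Range (S ^^ (n + m))" by auto
  also have "\<dots> = S `` Range (S ^^ m)" using Suc by simp
  also have "\<dots> = Range (S ^^ Suc m)" by auto
  finally show ?case using assms by simp
qed simp

theorem theorem2p10:
  fixes M F :: "'a measure"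
    and \<Phi> \<Psi> :: "real \<Rightarrow> ennreal"
    and u w :: "'a \<Rightarrow> complex"
  assumes "complete_measure M" and "sigma_finite_measure M"
    and "sigma_finite_subalgebra M F"
    and "young_function \<Phi>" and "\<Psi> = complementary_young \<Phi>"
    and "u \<in> borel_measurable M" and "w \<in> borel_measurable M"
    and "cond_integrable M F (\<lambda>x. u x * w x)"
    and "esssup M (\<lambda>x. ennreal (cmod (w x)) *
           young_inverse \<Psi> (nn_cond_exp M F (\<lambda>x. \<Psi> (cmod (u x))) x)) < \<infinity>"
    and "\<exists>\<delta>>0. AE x in M. cond_exp M F (\<lambda>x. u x * w x) x \<noteq> 0 \<longrightarrow>
           cmod (cond_exp M F (\<lambda>x. u x * w x) x) \<ge> \<delta>"
  shows "(\<forall>n::nat. n \<ge> 1 \<longrightarrow>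
           Range (op_power (orlicz_space M \<Phi>) (wct_op M F \<Phi> w u) (n + 2)) =
           Range (op_power (orlicz_space M \<Phi>) (wct_op M F \<Phi> w u) 2)) \<and>
         descent (orlicz_space M \<Phi>) (wct_op M F \<Phi> w u) < \<infinity>"
proof -
  let ?V = "orlicz_space M \<Phi>" and ?T = "wct_op M F \<Phi> w u"
  obtain \<delta> where \<delta>: "\<delta> > 0" "AE x in M. cond_exp M F (\<lambda>x. u x * w x) x \<noteq> 0 \<longrightarrow>
           cmod (cond_exp M F (\<lambda>x. u x * w x) x) \<ge> \<delta>"
    using assms(10) by blast
  have power: "op_power ?V ?T k = ?T ^^ k" if "k \<ge> 1" for k
    by (rule op_power_eq_relpow[OF wct_op_subset that])
  have "Z \<in> Range (?T ^^ 3)" if Z: "Z \<in> Range (?T ^^ 2)" for Z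
  proof -
    obtain X where "(X, Z) \<in> ?T ^^ Suc (Suc 0)"
      using Z unfolding numeral_2_eq_2 by blast
    then obtain Y where "(X, Y) \<in> ?T" "(Y, Z) \<in> ?T" by auto
    then show ?thesis
      using wct_op_square_range_subset[OF assms(3,4,6,7,8) \<delta>] by blast
  qed
  moreover have "Range (?T ^^ 3) \<subseteq> Range (?T ^^ 2)"
  proof
    fix Z assume "Z \<in> Range (?T ^^ 3)"
    then obtain X where "(X, Z) \<in> ?T ^^ Suc 2" by (auto simp: eval_nat_numeral)
    then show "Z \<in> Range (?T ^^ 2)" by (blast dest: relpow_Suc_D2)
  qed
  ultimately have "Range (?T ^^ 3) = Range (?T ^^ 2)" by blast
  moreover have "(3::nat) = Suc 2" by simp
  ultimately have "Range (?T ^^ Suc 2) = Range (?T ^^ 2)" by (simp only:)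
  from Range_relpow_stable[OF this]
  have stable: "Range (op_power ?V ?T (n + 2)) = Range (op_power ?V ?T 2)" for n
    by (simp add: power)
  have "descent ?V ?T \<le> enat 2"
    unfolding descent_def using stable[of 1] by (intro Inf_lower) (auto simp: eval_nat_numeral)
  then have "descent ?V ?T < \<infinity>"
    by (rule le_less_trans) simp
  with stable show ?thesis by blast
qed

end
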